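(* Let $\alpha\in\mathbb R_{>1}$, $\varepsilon\in\mathbb R_{>0}$ and $k\in\mathbb N$. Let $D\subseteq\mathbb C^{+}$ be an admissible domain of type $(\alpha,\varepsilon,k)$. For $C>\exp^{\circ k}(0)$, let $f:D_C\to\mathbb C$ be an analytic map such that $$f(\zeta)=\alpha\zeta+o(\boldsymbol L_k^{-\varepsilon})\quad\text{as }\Re(\zeta)\to+\infty,\ \text{uniformly on }D_C .$$ Then: 1. (Existence) For a sufficiently large $R>\exp^{\circ k}(0)$ there exists an analytic normalizing map $\varphi$ on the $f$-invariant subdomain $D_R^{f}\subseteq D$. That is, $\varphi$ satisfies $$(\varphi\circ f)(\zeta)=\alpha\cdot\varphi(\zeta)\quad\text{for all }\zeta\in D_R^{f}.$$ Moreover, $\varphi$ is the uniform limit on $D_R^{f}$ of the sequence $\left(\frac1{\alpha^{n}}f^{\circ n}\right)_n$ (the Böttcher sequence written in the variable $\zeta=-\log z$). 2. If $D_R^{f}\cap\{\zeta\in\mathbb C^{+}:\Im(\zeta)=0\}$ is $f$-invariant, then it is also $\varphi$-invariant. 3. (Asymptotics) The normalization $\varphi$ is tangent to the identity, i.e., $\varphi(\zeta)=\zeta+o(1)$, uniformly on $D_R^{f}\subseteq\mathbb C^{+}$, as $\Re(\zeta)\to+\infty$. In particular, for every $0<\nu<\varepsilon$, it follows that $\varphi(\zeta)=\zeta+o(\boldsymbol L_k^{-\nu})$, uniformly as $\Re(\zeta)\to+\infty$, on every subdomain $D_{h_l,h_u}\subseteq D_R^{f}$ such that $h_l(x)=O(x)$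 and $h_u(x)=O(x)$. 4. (Uniqueness) Let $\psi:D_1\to\mathbb C$ be a normalization of $f$ (i.e. an analytic map with $\psi\circ f=\alpha\cdot\psi$) on an $f$-invariant subset $D_1\subseteq D$, such that $\psi(\zeta)=\zeta+o(1)$ uniformly on $D_1$, as $\Re(\zeta)\to+\infty$. Then $\psi\equiv\varphi$ on $(D_1)_R$, where $R$ is from statement 1.
   Context: $\mathbb N=\{0,1,2,\dots\}$; $\mathbb C^{+}=\{\zeta\in\mathbb C:\Re(\zeta)>0\}$; $\log^{\circ k}$, $\exp^{\circ k}$ denote $k$-fold iterates. For $\alpha>1$, $\varepsilon>0$, $k\in\mathbb N$ and $x>\exp^{\circ k}(0)$ put $$M_{\varepsilon,k}(x):=\frac1{(\log^{\circ k}x)^{\varepsilon}},\qquad \rho_{\alpha,\varepsilon,k}(x):=(\alpha-1)x-M_{\varepsilon,k}(x).$$ Let $t>\exp^{\circ k}(0)$ be such that $\rho_{\alpha,\varepsilon,k}>0$ on $[t,+\infty)$. A pair of maps $h_l,h_u:[t,+\infty)\to\mathbb R$ is a lower-upper pair of type $(\alpha,\varepsilon,k)$ if: (i) $h_l<h_u$ on $[t,+\infty)$; (ii) $h_l$ is decreasing and $h_l(x+\rho_{\alpha,\varepsilon,k}(x))-h_l(x)\le(\alpha-1)h_l(x)-M_{\varepsilon,k}(x)$ for $x\ge t$; (iii) $h_u$ is increasing and $h_u(x+\rho_{\alpha,\varepsilon,k}(x))-h_u(x)\ge(\alpha-1)h_u(x)+M_{\varepsilon,k}(x)$ for $x\ge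 t$. For such a pair put $$D_{h_l,h_u}:=\{\zeta\in\mathbb C:\Re(\zeta)\ge t,\ h_l(\Re(\zeta))<\Im(\zeta)<h_u(\Re(\zeta))\}.$$ A domain of type $(\alpha,\varepsilon,k)$ is a union of an arbitrary nonempty collection of sets of the form $D_{h_l,h_u}$ (with lower-upper pairs of type $(\alpha,\varepsilon,k)$). A subset $D\subseteq\mathbb C$ containing a domain of type $(\alpha,\varepsilon,k)$ is called an admissible domain of type $(\alpha,\varepsilon,k)$. (The sets called domains here, such as $D_{h_l,h_u}$, need not be open.) For $D\subseteq\mathbb C$ and $R>0$, $D_R:=D\cap([R,+\infty)\times\mathbb R)=\{\zeta\in D:\Re(\zeta)\ge R\}$. A set $A$ is $f$-invariant if $f(A)\subseteq A$, and likewise $\varphi$-invariant if $\varphi(A)\subseteq A$. $D^{f}$ denotes the maximal $f$-invariant subdomain of $D$, i.e. the union of all $f$-invariant subdomains of $D$ (on which $f$ is defined), and $D_R^{f}:=(D^{f})_R$. $\boldsymbol L_1:=\log\zeta$, $\boldsymbol L_{j}:=\log(\boldsymbol L_{j-1})$ with the principal branch of the logarithm (well defined for $\Re(\zeta)>\exp^{\circ k}(0)$, $j\le k$); $\boldsymbol L_0:=\zeta$.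
   Formalization: Item 2 is false as worded (f(z)=2z−z⁻² on C⁺ gives φ(R)<R); it is replaced by: φ maps the real points of D_R^f into the positive real axis. On non-open sets "analytic" means continuous and holomorphic in the interior (near every point on parts of type (α,ε,k), if f is so on D_C). *)

theory Defs
  imports "HOL-Analysis.Analysis" "HOL-Library.Landau_Symbols"
begin

(* The iterated logarithm below is only meaningful for x > (exp ^^ k) 0,
   where it is positive; every use is restricted to such x. *)
definition M_fun :: "real \<Rightarrow> nat \<Rightarrow> real \<Rightarrow> real" where
  "M_fun \<epsilon> k x = 1 / ((ln ^^ k) x) powr \<epsilon>"

definition rho :: "real \<Rightarrow> real \<Rightarrow> nat \<Rightarrow> real \<Rightarrow> real" where
  "rho \<alpha> \<epsilon> k x = (\<alpha> - 1) * x - M_fun \<epsilon> k x"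

(* "Decreasing" and "increasing" are read in the weak sense. *)
definition lower_upper_pair ::
    "real \<Rightarrow> real \<Rightarrow> nat \<Rightarrow> real \<Rightarrow> (real \<Rightarrow> real) \<Rightarrow> (real \<Rightarrow> real) \<Rightarrow> bool" where
  "lower_upper_pair \<alpha> \<epsilon> k t hl hu \<longleftrightarrow>
     t > (exp ^^ k) 0 \<and>
     (\<forall>x\<ge>t. rho \<alpha> \<epsilon> k x > 0) \<and>
     (\<forall>x\<ge>t. hl x < hu x) \<and>
     antimono_on {t..} hl \<and>
     (\<forall>x\<ge>t. hl (x + rho \<alpha> \<epsilon> k x) - hl x \<le> (\<alpha> - 1) * hl x - M_fun \<epsilon> k x) \<and>
     mono_on {t..} hu \<and>
     (\<forall>x\<ge>t. hu (x + rho \<alpha> \<epsilon> k x) - hu x \<ge> (\<alpha> - 1) * hu x + M_fun \<epsilon> k x)"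

definition region :: "real \<Rightarrow> (real \<Rightarrow> real) \<Rightarrow> (real \<Rightarrow> real) \<Rightarrow> complex set" where
  "region t hl hu = {\<zeta>. Re \<zeta> \<ge> t \<and> hl (Re \<zeta>) < Im \<zeta> \<and> Im \<zeta> < hu (Re \<zeta>)}"

(* The left end point t may differ from member to member of the collection P. *)
definition type_domain :: "real \<Rightarrow> real \<Rightarrow> nat \<Rightarrow> complex set \<Rightarrow> bool" where
  "type_domain \<alpha> \<epsilon> k E \<longleftrightarrow>
     (\<exists>P. P \<noteq> {} \<and> (\<forall>(t, hl, hu) \<in> P. lower_upper_pair \<alpha> \<epsilon> k t hl hu) \<and>
          E = (\<Union>(t, hl, hu) \<in> P. region t hl hu))"

definition admissible_domain :: "real \<Rightarrow> real \<Rightarrow> nat \<Rightarrow> complex set \<Rightarrow> bool" where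
  "admissible_domain \<alpha> \<epsilon> k D \<longleftrightarrow> (\<exists>E. type_domain \<alpha> \<epsilon> k E \<and> E \<subseteq> D)"

definition right_part :: "complex set \<Rightarrow> real \<Rightarrow> complex set" where
  "right_part D R = {\<zeta> \<in> D. Re \<zeta> \<ge> R}"

definition invariant_under :: "(complex \<Rightarrow> complex) \<Rightarrow> complex set \<Rightarrow> bool" where
  "invariant_under f A \<longleftrightarrow> f ` A \<subseteq> A"

(* To be applied with S the set on which f is given; only f restricted to S matters. *)
definition max_invariant :: "(complex \<Rightarrow> complex) \<Rightarrow> complex set \<Rightarrow> complex set" where
  "max_invariant f S = \<Union>{A. A \<subseteq> S \<and> invariant_under f A}"

(* The set D_R^f for a map f given on D_C = right_part D C. *)
definition inv_right_part ::
    "(complex \<Rightarrow> complex) \<Rightarrow> complex set \<Rightarrow> real \<Rightarrow> real \<Rightarrow> complex set" where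
  "inv_right_part f D C R = right_part (max_invariant f (right_part D C)) R"

definition L_fun :: "nat \<Rightarrow> complex \<Rightarrow> complex" where
  "L_fun k \<zeta> = (Ln ^^ k) \<zeta>"

(* An estimate o[re_at_top S](g) is an estimate o(g) that is uniform on S as Re \<zeta> \<rightarrow> +\<infinity>. *)
definition re_at_top :: "complex set \<Rightarrow> complex filter" where
  "re_at_top S = inf (filtercomap Re at_top) (principal S)"

(* Analytic maps on sets that need not be open. Holomorphy in a neighbourhood of each
   point of S, i.e. f analytic_on S, implies analytic_map f S; for open S they agree.
   The latter cannot be used throughout: holomorphic extendability across boundary
   points is not inherited by uniform limits on a non-open invariant set, since the
   neighbourhoods to which the iterates of f extend may shrink to the point. *)
definition analytic_map :: "(complex \<Rightarrow> complex) \<Rightarrow> complex set \<Rightarrow> bool" where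
  "analytic_map f S \<longleftrightarrow> continuous_on S f \<and> f holomorphic_on interior S"

end

theory Submission
  imports Defs "HOL-Complex_Analysis.Conformal_Mappings"
begin

text \<open>
  Since \<open>Re L_k \<ge> ln^k Re\<close>, far to the right the map \<open>f\<close> differs from multiplication by
  \<open>\<alpha>\<close> by at most half of \<open>M_fun\<close>. The defining inequalities of a lower-upper pair say exactly that
  such a map sends the region into itself; the factor one half even places the image in the interior.
  The increments of \<open>f^n / \<alpha>^n\<close> are then dominated by the geometric series
  \<open>M_fun (Re \<zeta>) / \<alpha>^(n+1)\<close>, which yields existence, the invariance of the real axis and the
  asymptotics at once. Uniqueness holds because \<open>\<psi> = (\<psi> \<circ> f^n) / \<alpha>^n\<close> for every
  normalization \<open>\<psi>\<close>.
\<close>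

section \<open>Iterated logarithms\<close>

text \<open>The inductions on \<open>k\<close> below strip the innermost logarithm first, so the
  threshold has to pass from \<open>x\<close> to \<open>ln x\<close>.\<close>

lemma less_ln_if_exp_funpow_less:
  fixes x :: real
  assumes "(exp ^^ Suc k) 0 < x"
  shows "0 < x" and "(exp ^^ k) 0 < ln x"
proof -
  show "0 < x" using assms less_trans[OF exp_gt_zero] by simp
  then show "(exp ^^ k) 0 < ln x" using assms by (subst exp_less_cancel_iff[symmetric]) simp
qed

lemma funpow_ln_pos:
  fixes x :: real
  assumes "x > (exp ^^ k) 0"
  shows "(ln ^^ k) x > 0"
  using assms
proof (induction k arbitrary: x)
  case (Suc k)
  then show ?case
    using Suc.IH[OF less_ln_if_exp_funpow_less(2)] by (simp add: funpow_swap1)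
qed simp

text \<open>Each step rests on \<open>Re (Ln z) = ln (norm z)\<close> and
  \<open>norm z \<ge> Re z\<close>. The real \<open>x\<close> is kept apart from \<open>Re z\<close>
  because after one logarithm only \<open>ln x \<le> Re (Ln z)\<close> is known, not
  equality.\<close>

lemma funpow_ln_le_Re_L_fun:
  assumes "x > (exp ^^ k) 0" and "x \<le> Re z"
  shows "(ln ^^ k) x \<le> Re (L_fun k z)"
  using assms
proof (induction k arbitrary: x z)
  case 0
  then show ?case by (simp add: L_fun_def)
next
  case (Suc k)
  note x = less_ln_if_exp_funpow_less(1)[OF Suc.prems(1)]
    and lx = less_ln_if_exp_funpow_less(2)[OF Suc.prems(1)]
  have nz: "x \<le> norm z"
    using Suc.prems complex_Re_le_cmod[of z] by linarith
  then have "z \<noteq> 0" using x by auto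
  then have "ln x \<le> Re (Ln z)"
    using x nz by (simp add: ln_mono)
  then show ?case
    using Suc.IH[OF lx] by (simp add: L_fun_def funpow_swap1)
qed

lemma funpow_ln_mono:
  fixes x y :: real
  assumes "x > (exp ^^ k) 0" and "x \<le> y"
  shows "(ln ^^ k) x \<le> (ln ^^ k) y"
  using assms
proof (induction k arbitrary: x y)
  case (Suc k)
  note x = less_ln_if_exp_funpow_less(1)[OF Suc.prems(1)]
    and lx = less_ln_if_exp_funpow_less(2)[OF Suc.prems(1)]
  have "ln x \<le> ln y" using x Suc.prems by (simp add: ln_mono)
  then show ?case
    using Suc.IH[OF lx] by (simp add: funpow_swap1)
qed simp

lemma filterlim_funpow_ln: "filterlim (ln ^^ k :: real \<Rightarrow> real) at_top at_top"
proof (induction k)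
  case 0
  then show ?case by (simp add: id_def filterlim_ident)
next
  case (Suc k)
  then show ?case by (simp add: o_def filterlim_compose[OF ln_at_top])
qed

text \<open>A converse to \<open>funpow_ln_le_Re_L_fun\<close>. The sector condition enters only at
  \<open>k = 0\<close>; each further logarithm turns the factor \<open>B\<close> into the summand
  \<open>ln B\<close> and adds an argument of modulus at most pi.\<close>

lemma norm_L_fun_le_on_sector:
  "\<exists>B>0. \<exists>X. \<forall>z. X \<le> Re z \<and> norm z \<le> K * Re z \<longrightarrow> norm (L_fun k z) \<le> B * (ln ^^ k) (Re z)"
proof (induction k)
  case 0
  show ?case
  proof (rule exI[of _ "\<bar>K\<bar> + 1"], rule conjI[rotated], rule exI[of _ 0], intro allI impI)
    fix z assume z: "0 \<le> Re z \<and> norm z \<le> K * Re z"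
    have "K * Re z \<le> (\<bar>K\<bar> + 1) * Re z" using z by (intro mult_right_mono) auto
    then show "norm (L_fun 0 z) \<le> (\<bar>K\<bar> + 1) * (ln ^^ 0) (Re z)" using z by (simp add: L_fun_def)
  qed auto
next
  case (Suc k)
  then obtain B X where B: "B > 0"
    and X: "\<And>z. X \<le> Re z \<Longrightarrow> norm z \<le> K * Re z \<Longrightarrow> norm (L_fun k z) \<le> B * (ln ^^ k) (Re z)"
    by blast
  obtain N where N: "\<And>x. x \<ge> N \<Longrightarrow> (ln ^^ k) x \<ge> (1::real)"
    using filterlim_funpow_ln[of k]
    unfolding filterlim_at_top eventually_at_top_linorder by blast
  obtain N' where N': "\<And>x. x \<ge> N' \<Longrightarrow> (ln ^^ Suc k) x \<ge> (1::real)"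
    using filterlim_funpow_ln[of "Suc k"]
    unfolding filterlim_at_top eventually_at_top_linorder by blast
  \<comment> \<open>Beyond \<open>Y\<close> the norm of \<open>L_fun k z\<close> is at least 1, so
    its logarithm is nonnegative, and the next iterated logarithm is at least 1, so it can absorb
    additive constants into a factor.\<close>
  define Y where "Y = Max {X, N, N', (exp ^^ k) 0 + 1}"
  have Y: "X \<le> Y" "N \<le> Y" "N' \<le> Y" "(exp ^^ k) 0 < Y"
    unfolding Y_def by (auto simp: less_max_iff_disj)
  show ?case
  proof (rule exI[of _ "1 + pi + \<bar>ln B\<bar>"], rule conjI[rotated], rule exI[of _ Y], intro allI impI)
    show "0 < 1 + pi + \<bar>ln B\<bar>" using pi_gt_zero by linarith
    fix z assume z: "Y \<le> Re z \<and> norm z \<le> K * Re z"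
    let ?l = "(ln ^^ k) (Re z)"
    have l: "1 \<le> ?l" "1 \<le> ln ?l" using N[of "Re z"] N'[of "Re z"] z Y by auto
    have "?l \<le> Re (L_fun k z)" using funpow_ln_le_Re_L_fun[of k "Re z" z] z Y by simp
    then have n1: "1 \<le> norm (L_fun k z)" using l complex_Re_le_cmod[of "L_fun k z"] by linarith
    have n2: "norm (L_fun k z) \<le> B * ?l" using X z Y by auto
    have nz: "L_fun k z \<noteq> 0" using n1 by auto
    have "ln (norm (L_fun k z)) \<le> ln (B * ?l)" using n1 n2 B l by (intro ln_mono) auto
    also have "\<dots> = ln B + ln ?l" using B l by (simp add: ln_mult)
    finally have up: "ln (norm (L_fun k z)) \<le> \<bar>ln B\<bar> + ln ?l" by linarith
    have "norm (Ln (L_fun k z)) \<le> \<bar>Re (Ln (L_fun k z))\<bar> + \<bar>Im (Ln (L_fun k z))\<bar>"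
      by (rule cmod_le)
    also have "\<dots> \<le> (\<bar>ln B\<bar> + ln ?l) + pi"
      using up n1 nz mpi_less_Im_Ln[OF nz] Im_Ln_le_pi[OF nz] by simp
    also have "\<dots> \<le> (1 + pi + \<bar>ln B\<bar>) * ln ?l"
      using mult_left_mono[OF l(2), of "pi + \<bar>ln B\<bar>"] by (simp add: algebra_simps)
    finally show "norm (L_fun (Suc k) z) \<le> (1 + pi + \<bar>ln B\<bar>) * (ln ^^ Suc k) (Re z)"
      by (simp add: L_fun_def)
  qed
qed

section \<open>Size of \<open>M_fun\<close> and its comparison with powers of
  \<open>L_fun\<close>\<close>

lemma M_fun_pos: "x > (exp ^^ k) 0 \<Longrightarrow> M_fun \<epsilon> k x > 0"
  using funpow_ln_pos[of k x] by (simp add: M_fun_def)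

lemma M_fun_antimono:
  assumes "\<epsilon> > 0" and "x > (exp ^^ k) 0" and "x \<le> y"
  shows "M_fun \<epsilon> k y \<le> M_fun \<epsilon> k x"
  using powr_mono2'[OF _ funpow_ln_pos[OF assms(2)] funpow_ln_mono[OF assms(2,3)], of "- \<epsilon>"] assms(1)
  by (simp add: M_fun_def powr_minus_divide)

lemma M_fun_tendsto_0:
  assumes "\<epsilon> > 0"
  shows "(M_fun \<epsilon> k \<longlongrightarrow> 0) at_top"
proof -
  have "((\<lambda>x. ((ln ^^ k) x) powr (- \<epsilon>)) \<longlongrightarrow> 0) at_top"
    using assms by (intro tendsto_neg_powr filterlim_funpow_ln) auto
  then show ?thesis
    by (simp add: M_fun_def[abs_def] powr_minus_divide)
qed

lemma norm_powr_of_real: "norm (z powr of_real a) = norm z powr a" for z :: complex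
  by (subst norm_powr_real_powr') auto

text \<open>Translates the error term in \<open>L_fun\<close>, in which the perturbation is given,
  into the real quantity in which lower-upper pairs are defined. The negative exponent reverses the
  lower bound on the norm of \<open>L_fun\<close>.\<close>

lemma norm_L_fun_powr_le_M_fun:
  assumes "\<epsilon> > 0" and "Re z > (exp ^^ k) 0"
  shows "norm (L_fun k z powr of_real (- \<epsilon>)) \<le> M_fun \<epsilon> k (Re z)"
proof -
  have p: "0 < (ln ^^ k) (Re z)" by (rule funpow_ln_pos[OF assms(2)])
  have "(ln ^^ k) (Re z) \<le> norm (L_fun k z)"
    using funpow_ln_le_Re_L_fun[OF assms(2) order_refl] complex_Re_le_cmod[of "L_fun k z"] by linarith
  then have "norm (L_fun k z) powr (- \<epsilon>) \<le> (ln ^^ k) (Re z) powr (- \<epsilon>)"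
    using p assms by (intro powr_mono2') auto
  then show ?thesis
    by (simp only: norm_powr_of_real M_fun_def powr_minus_divide)
qed

lemma eventually_re_at_top:
  "eventually P (re_at_top S) \<longleftrightarrow> (\<exists>N. \<forall>z\<in>S. N \<le> Re z \<longrightarrow> P z)"
  unfolding re_at_top_def eventually_inf_principal eventually_filtercomap_at_top_linorder by blast

text \<open>With \<open>l = (ln ^^ k) (Re z)\<close>, \<open>M_fun\<close> splits as
  \<open>l powr (\<nu> - \<epsilon>) * l powr (- \<nu>)\<close>. The first factor tends to 0; the
  second is bounded by a multiple of the norm of \<open>L_fun k z powr (- \<nu>)\<close>, which
  takes an upper bound on \<open>L_fun\<close> and hence the sector.\<close>

lemma M_fun_smallo_on_sector:
  assumes "0 < \<nu>" "\<nu> < \<epsilon>" and sector: "\<And>z. z \<in> S \<Longrightarrow> X \<le> Re z \<Longrightarrow> norm z \<le> K * Re z"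
  shows "(\<lambda>z. of_real (M_fun \<epsilon> k (Re z))) \<in> o[re_at_top S](\<lambda>z. L_fun k z powr of_real (- \<nu>))"
proof (rule landau_o.smallI)
  fix c :: real assume c: "c > 0"
  obtain B X1 where B: "B > 0"
    and X1: "\<And>z. X1 \<le> Re z \<Longrightarrow> norm z \<le> K * Re z \<Longrightarrow> norm (L_fun k z) \<le> B * (ln ^^ k) (Re z)"
    using norm_L_fun_le_on_sector[of K k] by blast
  have "((\<lambda>x. ((ln ^^ k) x) powr (\<nu> - \<epsilon>)) \<longlongrightarrow> 0) at_top"
    using assms by (intro tendsto_neg_powr filterlim_funpow_ln) auto
  \<comment> \<open>The factor \<open>B powr (- \<nu>)\<close> in the threshold compensates for the
    constant \<open>B\<close> in \<open>norm (L_fun k z) \<le> B * l\<close>.\<close>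
  then have "\<forall>\<^sub>F x in at_top. ((ln ^^ k) x) powr (\<nu> - \<epsilon>) < c * B powr (- \<nu>)"
    using c B by (intro order_tendstoD) auto
  then obtain X2 where X2: "\<And>x. X2 \<le> x \<Longrightarrow> ((ln ^^ k) x) powr (\<nu> - \<epsilon>) < c * B powr (- \<nu>)"
    unfolding eventually_at_top_linorder by blast
  define Y where "Y = Max {X, X1, X2, (exp ^^ k) 0 + 1}"
  have Y: "X \<le> Y" "X1 \<le> Y" "X2 \<le> Y" "(exp ^^ k) 0 < Y"
    unfolding Y_def by (auto simp: less_max_iff_disj)
  have "norm (complex_of_real (M_fun \<epsilon> k (Re z))) \<le> c * norm (L_fun k z powr of_real (- \<nu>))"
    if z: "z \<in> S" "Y \<le> Re z" for z
  proof -
    let ?l = "(ln ^^ k) (Re z)"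
    have l: "?l > 0" using z Y by (intro funpow_ln_pos) auto
    have "?l \<le> norm (L_fun k z)"
      using funpow_ln_le_Re_L_fun[of k "Re z" z] complex_Re_le_cmod[of "L_fun k z"] z Y by simp
    moreover have "norm (L_fun k z) \<le> B * ?l" using z Y X1 sector by auto
    ultimately have "(B * ?l) powr (- \<nu>) \<le> norm (L_fun k z) powr (- \<nu>)"
      using l assms by (intro powr_mono2') auto
    then have *: "c * (B powr (- \<nu>) * ?l powr (- \<nu>)) \<le> c * norm (L_fun k z) powr (- \<nu>)"
      using c B l by (simp add: powr_mult)
    have "M_fun \<epsilon> k (Re z) = ?l powr (\<nu> - \<epsilon>) * ?l powr (- \<nu>)"
      using l by (simp add: M_fun_def powr_minus_divide[of _ \<epsilon>] flip: powr_add)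
    also have "\<dots> \<le> (c * B powr (- \<nu>)) * ?l powr (- \<nu>)"
      using X2[of "Re z"] z Y by (intro mult_right_mono) auto
    finally show ?thesis
      using * order_less_imp_le[OF M_fun_pos[of k "Re z" \<epsilon>]] z Y
      by (simp add: norm_powr_of_real mult.assoc del: of_real_minus)
  qed
  then show "\<forall>\<^sub>F z in re_at_top S. norm (complex_of_real (M_fun \<epsilon> k (Re z))) \<le> c * norm (L_fun k z powr of_real (- \<nu>))"
    unfolding eventually_re_at_top by blast
qed

section \<open>Invariance of the regions\<close>

text \<open>With \<open>x' = \<alpha> * x - M_fun \<epsilon> k x\<close>, which is
  \<open>x + rho \<alpha> \<epsilon> k x\<close>, the point \<open>w\<close> has real part beyond
  \<open>x'\<close>, and the two step inequalities put \<open>Im w\<close> strictly between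
  \<open>hl x'\<close> and \<open>hu x'\<close>. Monotonicity of \<open>hl\<close> and
  \<open>hu\<close> keeps these bounds valid to the right of \<open>x'\<close>.\<close>

lemma region_step:
  assumes pair: "lower_upper_pair \<alpha> \<epsilon> k t hl hu" and "\<alpha> > 1"
    and z: "z \<in> region t hl hu" and w: "norm (w - of_real \<alpha> * z) < M_fun \<epsilon> k (Re z)"
  shows "w \<in> interior (region t hl hu)"
proof -
  define x where "x = Re z"
  define x' where "x' = x + rho \<alpha> \<epsilon> k x"
  have x: "t \<le> x" and zl: "hl x < Im z" and zu: "Im z < hu x"
    using z by (auto simp: region_def x_def)
  have mono: "\<And>y. x' \<le> y \<Longrightarrow> hl y \<le> hl x'" "\<And>y. x' \<le> y \<Longrightarrow> hu x' \<le> hu y"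
    and stepl: "hl x' \<le> \<alpha> * hl x - M_fun \<epsilon> k x" and stepu: "\<alpha> * hu x + M_fun \<epsilon> k x \<le> hu x'"
    and tx': "t \<le> x'"
  proof -
    have r: "rho \<alpha> \<epsilon> k x > 0" using pair x by (auto simp: lower_upper_pair_def)
    then show tx': "t \<le> x'" using x by (simp add: x'_def)
    show "hl x' \<le> \<alpha> * hl x - M_fun \<epsilon> k x" "\<alpha> * hu x + M_fun \<epsilon> k x \<le> hu x'"
      using pair x unfolding x'_def lower_upper_pair_def by (fastforce simp: algebra_simps)+
    show "hl y \<le> hl x'" "hu x' \<le> hu y" if "x' \<le> y" for y
      using pair tx' that by (auto simp: lower_upper_pair_def monotone_on_def)
  qed
  \<comment> \<open>An open half-strip with the bounds frozen at \<open>x'\<close>; it witnesses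
    that \<open>w\<close> is an interior point.\<close>
  define U where "U = {v. x' < Re v} \<inter> {v. hl x' < Im v} \<inter> {v. Im v < hu x'}"
  have "open U"
    unfolding U_def by (intro open_Int open_halfspace_Re_gt open_halfspace_Im_gt open_halfspace_Im_lt)
  moreover have "U \<subseteq> region t hl hu"
  proof
    fix v assume "v \<in> U"
    then show "v \<in> region t hl hu"
      using mono[of "Re v"] tx' by (auto simp: U_def region_def)
  qed
  moreover have "w \<in> U"
  proof -
    have "\<bar>Re w - \<alpha> * x\<bar> < M_fun \<epsilon> k x" "\<bar>Im w - \<alpha> * Im z\<bar> < M_fun \<epsilon> k x"
      using w abs_Re_le_cmod[of "w - of_real \<alpha> * z"] abs_Im_le_cmod[of "w - of_real \<alpha> * z"]
      by (auto simp: x_def)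
    moreover have "\<alpha> * hl x < \<alpha> * Im z" "\<alpha> * Im z < \<alpha> * hu x" using zl zu \<open>\<alpha> > 1\<close> by auto
    moreover have "x' = \<alpha> * x - M_fun \<epsilon> k x" by (simp add: x'_def rho_def algebra_simps)
    ultimately show ?thesis using stepl stepu unfolding U_def by auto
  qed
  ultimately show ?thesis by (meson interiorI)
qed

lemma lower_upper_pair_right:
  "lower_upper_pair \<alpha> \<epsilon> k t hl hu \<Longrightarrow> lower_upper_pair \<alpha> \<epsilon> k (max t R) hl hu"
  by (auto simp: lower_upper_pair_def monotone_on_def)

lemma right_part_region: "right_part (region t hl hu) R = region (max t R) hl hu"
  by (auto simp: right_part_def region_def)

text \<open>All conditions on a pair quantify over \<open>x \<ge> t\<close>, so they survive raising
  every left end point to \<open>max t R\<close>. This is needed because the perturbation is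
  controlled only far to the right.\<close>

lemma type_domain_right_part:
  assumes "type_domain \<alpha> \<epsilon> k E"
  shows "type_domain \<alpha> \<epsilon> k (right_part E R)"
proof -
  obtain P where P: "P \<noteq> {}" "\<forall>(t, hl, hu) \<in> P. lower_upper_pair \<alpha> \<epsilon> k t hl hu"
    "E = (\<Union>(t, hl, hu) \<in> P. region t hl hu)"
    using assms unfolding type_domain_def by blast
  let ?P = "(\<lambda>(t, hl, hu). (max t R, hl, hu)) ` P"
  have "right_part E R = (\<Union>p\<in>P. right_part (case p of (t, hl, hu) \<Rightarrow> region t hl hu) R)"
    unfolding P(3) by (auto simp: right_part_def)
  also have "\<dots> = (\<Union>(t, hl, hu) \<in> ?P. region t hl hu)"
    by (auto simp: right_part_region split: prod.splits)
  finally show ?thesis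
    unfolding type_domain_def using P(1,2)
    by (intro exI[of _ ?P]) (auto intro: lower_upper_pair_right)
qed

lemma type_domain_step:
  assumes "type_domain \<alpha> \<epsilon> k E" and "\<alpha> > 1"
    and "z \<in> E" and "norm (w - of_real \<alpha> * z) < M_fun \<epsilon> k (Re z)"
  shows "w \<in> interior E"
proof -
  obtain P where P: "\<forall>(t, hl, hu) \<in> P. lower_upper_pair \<alpha> \<epsilon> k t hl hu"
    "E = (\<Union>(t, hl, hu) \<in> P. region t hl hu)"
    using assms(1) unfolding type_domain_def by blast
  then obtain t hl hu where p: "(t, hl, hu) \<in> P" "z \<in> region t hl hu"
    using assms(3) by auto
  then have "w \<in> interior (region t hl hu)"
    using P(1) assms(2,4) region_step by blast
  moreover have "region t hl hu \<subseteq> E" using P(2) p(1) by auto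
  ultimately show ?thesis using interior_mono by blast
qed

text \<open>\<open>Im z\<close> lies between \<open>hl\<close> and \<open>hu\<close>, so its modulus
  is at most the sum of theirs, which is linear in \<open>Re z\<close>.\<close>

lemma region_sector:
  assumes "hl \<in> O[at_top](\<lambda>x. x)" "hu \<in> O[at_top](\<lambda>x. x)"
  shows "\<exists>K X. \<forall>z \<in> region t hl hu. X \<le> Re z \<longrightarrow> norm z \<le> K * Re z"
proof -
  obtain cl where "\<forall>\<^sub>F x in at_top. norm (hl x) \<le> cl * norm x" using assms(1) by (elim landau_o.bigE)
  moreover obtain cu where "\<forall>\<^sub>F x in at_top. norm (hu x) \<le> cu * norm x" using assms(2) by (elim landau_o.bigE)
  ultimately have "\<forall>\<^sub>F x in at_top. \<bar>hl x\<bar> \<le> cl * \<bar>x\<bar> \<and> \<bar>hu x\<bar> \<le> cu * \<bar>x\<bar> \<and> 0 \<le> x"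
    using eventually_ge_at_top[of 0] by eventually_elim auto
  then obtain X where X: "\<And>x. X \<le> x \<Longrightarrow> \<bar>hl x\<bar> \<le> cl * \<bar>x\<bar> \<and> \<bar>hu x\<bar> \<le> cu * \<bar>x\<bar> \<and> 0 \<le> x"
    unfolding eventually_at_top_linorder by blast
  have "norm z \<le> (1 + \<bar>cl\<bar> + \<bar>cu\<bar>) * Re z" if z: "z \<in> region t hl hu" "X \<le> Re z" for z
  proof -
    have x: "0 \<le> Re z" using X[OF z(2)] by simp
    have "cl * Re z \<le> \<bar>cl\<bar> * Re z" "cu * Re z \<le> \<bar>cu\<bar> * Re z" "0 \<le> \<bar>cl\<bar> * Re z" "0 \<le> \<bar>cu\<bar> * Re z"
      using x by (auto intro: mult_right_mono)
    then have "\<bar>Im z\<bar> \<le> \<bar>cl\<bar> * Re z + \<bar>cu\<bar> * Re z"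
      using X[OF z(2)] z(1) by (auto simp: region_def)
    then show ?thesis using cmod_le[of z] x by (simp add: algebra_simps)
  qed
  then show ?thesis by blast
qed

section \<open>The maximal invariant subset\<close>

lemma max_invariant_subset: "max_invariant f S \<subseteq> S"
  by (auto simp: max_invariant_def)

lemma max_invariant_maximal: "A \<subseteq> S \<Longrightarrow> invariant_under f A \<Longrightarrow> A \<subseteq> max_invariant f S"
  by (auto simp: max_invariant_def)

lemma invariant_max_invariant: "invariant_under f (max_invariant f S)"
  unfolding max_invariant_def invariant_under_def by blast

section \<open>The Boettcher limit\<close>

text \<open>Taking the limit on the whole plane makes the functional equation
  \<open>\<phi> \<circ> f = \<alpha> \<phi>\<close> available also outside the invariant set, wherever the limit exists
  after one step; this is what extends \<open>\<phi>\<close> analytically across boundary points.\<close>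

definition boettcher_limit :: "real \<Rightarrow> (complex \<Rightarrow> complex) \<Rightarrow> complex \<Rightarrow> complex" where
  "boettcher_limit \<alpha> f z = lim (\<lambda>n. 1 / of_real \<alpha> ^ n * (f ^^ n) z)"

text \<open>Forgets the shape of the regions and keeps an invariant set on which \<open>f\<close> is
  multiplication by \<alpha> up to an error \<open>m\<close>. On real parts \<open>f\<close> gains
  at least \<open>(\<alpha> - 1) * R \<ge> 2\<close> and loses at most \<open>m R \<le> 1\<close>,
  hence moves every point to the right by at least 1.\<close>

locale perturbed_scaling =
  fixes f :: "complex \<Rightarrow> complex" and \<alpha> R :: real and A :: "complex set" and m :: "real \<Rightarrow> real"
  assumes alpha: "\<alpha> > 1"
    and R_ge: "2 \<le> (\<alpha> - 1) * R"
    and inv: "f ` A \<subseteq> A"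
    and Re_ge: "z \<in> A \<Longrightarrow> R \<le> Re z"
    and close: "z \<in> A \<Longrightarrow> norm (f z - of_real \<alpha> * z) \<le> m (Re z)"
    and m_antimono: "R \<le> x \<Longrightarrow> x \<le> y \<Longrightarrow> m y \<le> m x"
    and m_le_1: "m R \<le> 1"
begin

abbreviation \<phi> where "\<phi> \<equiv> boettcher_limit \<alpha> f"

lemma iterate_in: "z \<in> A \<Longrightarrow> (f ^^ n) z \<in> A"
  using inv by (induction n) auto

lemma Re_step:
  assumes z: "z \<in> A"
  shows "Re z + 1 \<le> Re (f z)"
proof -
  have "m (Re z) \<le> 1" using m_antimono[OF order_refl Re_ge[OF z]] m_le_1 by linarith
  then have "\<bar>Re (f z - of_real \<alpha> * z)\<bar> \<le> 1"
    using close[OF z] abs_Re_le_cmod[of "f z - of_real \<alpha> * z"] by linarith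
  then have "\<alpha> * Re z - 1 \<le> Re (f z)" by simp
  moreover have "(\<alpha> - 1) * R \<le> (\<alpha> - 1) * Re z"
    using alpha Re_ge[OF z] by (intro mult_left_mono) auto
  ultimately show ?thesis using R_ge by (simp add: algebra_simps)
qed

text \<open>Linear growth is enough for two purposes: along an orbit the error \<open>m\<close>
  never exceeds its initial value, and every orbit eventually passes any given vertical
  line.\<close>

lemma Re_iterate: "z \<in> A \<Longrightarrow> Re z + real n \<le> Re ((f ^^ n) z)"
proof (induction n)
  case (Suc n)
  then show ?case using Re_step[OF iterate_in[of z n]] by simp
qed simp

text \<open>For \<open>w = (f ^^ n) z\<close> the increment equals
  \<open>(f w - \<alpha> * w) / \<alpha> ^ Suc n\<close>, and \<open>m (Re w) \<le> m (Re z)\<close>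
  because \<open>w\<close> lies to the right of \<open>z\<close>.\<close>

lemma increment_bound:
  assumes z: "z \<in> A"
  shows "norm (1 / of_real \<alpha> ^ Suc n * (f ^^ Suc n) z - 1 / of_real \<alpha> ^ n * (f ^^ n) z)
    \<le> m (Re z) * (1 / \<alpha>) ^ Suc n"
proof -
  let ?w = "(f ^^ n) z"
  have a: "complex_of_real \<alpha> \<noteq> 0" using alpha by simp
  have "1 / of_real \<alpha> ^ Suc n * f ?w - 1 / of_real \<alpha> ^ n * ?w
      = (f ?w - of_real \<alpha> * ?w) / of_real \<alpha> ^ Suc n"
    using a by (simp add: field_simps)
  then have "norm (1 / of_real \<alpha> ^ Suc n * (f ^^ Suc n) z - 1 / of_real \<alpha> ^ n * ?w)
      = norm (f ?w - of_real \<alpha> * ?w) / \<alpha> ^ Suc n"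
    using alpha by (simp add: norm_divide norm_mult norm_power)
  also have "\<dots> \<le> m (Re z) / \<alpha> ^ Suc n"
  proof (rule divide_right_mono)
    have "m (Re ?w) \<le> m (Re z)"
      using Re_iterate[OF z, of n] by (intro m_antimono Re_ge z) auto
    then show "norm (f ?w - of_real \<alpha> * ?w) \<le> m (Re z)"
      using close[OF iterate_in[OF z, of n]] by linarith
  qed (use alpha in auto)
  finally show ?thesis by (simp add: power_divide)
qed

lemma geometric: "(\<lambda>n. b * (1 / \<alpha>) ^ Suc n) sums (b / (\<alpha> - 1))"
proof -
  have "(\<lambda>n. (b / \<alpha>) * (1 / \<alpha>) ^ n) sums ((b / \<alpha>) * (1 / (1 - 1 / \<alpha>)))"
    using alpha by (intro sums_mult geometric_sums) auto
  moreover have "(b / \<alpha>) * (1 / (1 - 1 / \<alpha>)) = b / (\<alpha> - 1)"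
    using alpha by (simp add: field_simps)
  ultimately have "(\<lambda>n. (b / \<alpha>) * (1 / \<alpha>) ^ n) sums (b / (\<alpha> - 1))" by metis
  then show ?thesis by simp
qed

lemma m_le: "z \<in> A \<Longrightarrow> m (Re z) \<le> 1"
  using m_antimono[OF order_refl Re_ge] m_le_1 by fastforce

text \<open>Nonnegativity of \<open>m\<close> is not assumed; on real parts of points of
  \<open>A\<close> it follows because \<open>m\<close> bounds a norm.\<close>

lemma m_nonneg: "z \<in> A \<Longrightarrow> 0 \<le> m (Re z)"
  using close norm_ge_zero order_trans by blast

lemma telescope:
  "(\<Sum>i<n. 1 / of_real \<alpha> ^ Suc i * (f ^^ Suc i) z - 1 / of_real \<alpha> ^ i * (f ^^ i) z)
    = 1 / of_real \<alpha> ^ n * (f ^^ n) z - z"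
  using sum_lessThan_telescope[of "\<lambda>i. 1 / of_real \<alpha> ^ i * (f ^^ i) z" n] by simp

text \<open>Weierstrass M-test for the telescoping series of increments. The majorant uses
  \<open>m (Re z) \<le> 1\<close>, so it is independent of \<open>z\<close>.\<close>

lemma uniform_limit_boettcher:
  "uniform_limit A (\<lambda>n z. 1 / of_real \<alpha> ^ n * (f ^^ n) z) \<phi> sequentially"
proof -
  let ?g = "\<lambda>i z. 1 / of_real \<alpha> ^ Suc i * (f ^^ Suc i) z - 1 / of_real \<alpha> ^ i * (f ^^ i) z"
  have "uniform_limit A (\<lambda>n z. \<Sum>i<n. ?g i z) (\<lambda>z. \<Sum>i. ?g i z) sequentially"
  proof (rule Weierstrass_m_test)
    show "summable (\<lambda>n. 1 * (1 / \<alpha>) ^ Suc n)" using geometric sums_summable by blast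
    fix n z assume z: "z \<in> A"
    have "m (Re z) * (1 / \<alpha>) ^ Suc n \<le> 1 * (1 / \<alpha>) ^ Suc n"
      using m_le[OF z] alpha by (intro mult_right_mono) auto
    then show "norm (?g n z) \<le> 1 * (1 / \<alpha>) ^ Suc n"
      using increment_bound[OF z, of n] by linarith
  qed
  then have "uniform_limit A (\<lambda>n z. 1 / of_real \<alpha> ^ n * (f ^^ n) z - z) (\<lambda>z. \<Sum>i. ?g i z) sequentially"
    unfolding telescope .
  moreover have "uniform_limit A (\<lambda>n z. z) (\<lambda>z. z) sequentially" by (simp add: uniform_limit_iff)
  ultimately have "uniform_limit A (\<lambda>n z. (1 / of_real \<alpha> ^ n * (f ^^ n) z - z) + z) (\<lambda>z. (\<Sum>i. ?g i z) + z) sequentially"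
    by (rule uniform_limit_add)
  then have *: "uniform_limit A (\<lambda>n z. 1 / of_real \<alpha> ^ n * (f ^^ n) z) (\<lambda>z. (\<Sum>i. ?g i z) + z) sequentially"
    by simp
  \<comment> \<open>Pointwise uniqueness of limits identifies the \<open>lim\<close> in the
    definition of \<phi> with the sum of the series on \<open>A\<close>.\<close>
  have "\<phi> z = (\<Sum>i. ?g i z) + z" if "z \<in> A" for z
    unfolding boettcher_limit_def by (rule limI, rule tendsto_uniform_limitI[OF * that])
  then show ?thesis
    using * by (simp cong: uniform_limit_cong')
qed

lemma tendsto_boettcher: "z \<in> A \<Longrightarrow> (\<lambda>n. 1 / of_real \<alpha> ^ n * (f ^^ n) z) \<longlonglongrightarrow> \<phi> z"
  by (rule tendsto_uniform_limitI[OF uniform_limit_boettcher])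

text \<open>Partial sums of the increments are bounded by the full geometric series. Keeping
  \<open>m (Re z)\<close> instead of 1 as the factor makes this bound decay, which the asymptotics
  need.\<close>

lemma boettcher_norm_diff:
  assumes z: "z \<in> A"
  shows "norm (\<phi> z - z) \<le> m (Re z) / (\<alpha> - 1)"
proof (rule tendsto_upperbound)
  show "(\<lambda>n. norm (1 / of_real \<alpha> ^ n * (f ^^ n) z - z)) \<longlonglongrightarrow> norm (\<phi> z - z)"
    by (intro tendsto_intros tendsto_boettcher z)
  show "\<forall>\<^sub>F n in sequentially. norm (1 / of_real \<alpha> ^ n * (f ^^ n) z - z) \<le> m (Re z) / (\<alpha> - 1)"
  proof (rule always_eventually, rule allI)
    fix n
    have "norm (1 / of_real \<alpha> ^ n * (f ^^ n) z - z) \<le> (\<Sum>i<n. m (Re z) * (1 / \<alpha>) ^ Suc i)"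
      unfolding telescope[symmetric] by (rule sum_norm_le) (rule increment_bound[OF z])
    also have "\<dots> \<le> m (Re z) / (\<alpha> - 1)"
      unfolding sums_unique[OF geometric]
      using m_nonneg[OF z] alpha
      by (intro sum_le_suminf sums_summable[OF geometric]) auto
    finally show "norm (1 / of_real \<alpha> ^ n * (f ^^ n) z - z) \<le> m (Re z) / (\<alpha> - 1)" .
  qed
qed simp

text \<open>Shifted by one index, the sequence at \<open>z\<close> is the sequence at
  \<open>f z\<close> divided by \<alpha>. Only convergence at \<open>f z\<close> is used, so
  \<open>z\<close> may lie outside \<open>A\<close>.\<close>

lemma boettcher_eq_shift:
  assumes "f z \<in> A"
  shows "\<phi> z = \<phi> (f z) / of_real \<alpha>"
proof -
  have "(\<lambda>n. (1 / of_real \<alpha> ^ n * (f ^^ n) (f z)) / of_real \<alpha>) \<longlonglongrightarrow> \<phi> (f z) / of_real \<alpha>"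
    using alpha by (intro tendsto_divide tendsto_boettcher assms) auto
  then have "(\<lambda>n. 1 / of_real \<alpha> ^ Suc n * (f ^^ Suc n) z) \<longlonglongrightarrow> \<phi> (f z) / of_real \<alpha>"
    by (simp add: funpow_swap1 field_simps)
  then have "(\<lambda>n. 1 / of_real \<alpha> ^ n * (f ^^ n) z) \<longlonglongrightarrow> \<phi> (f z) / of_real \<alpha>"
    by (rule LIMSEQ_imp_Suc)
  then show ?thesis unfolding boettcher_limit_def[of \<alpha> f z] by (rule limI)
qed

lemma boettcher_functional: "z \<in> A \<Longrightarrow> \<phi> (f z) = of_real \<alpha> * \<phi> z"
  using boettcher_eq_shift[of z] inv alpha by auto

text \<open>\<phi> displaces \<open>z\<close> by at most \<open>1 / (\<alpha> - 1)\<close>, half of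
  the lower bound \<open>2 / (\<alpha> - 1)\<close> for \<open>R\<close>.\<close>

lemma Re_boettcher_pos:
  assumes z: "z \<in> A"
  shows "Re (\<phi> z) > 0"
proof -
  have "norm (\<phi> z - z) \<le> 1 / (\<alpha> - 1)"
    using boettcher_norm_diff[OF z] divide_right_mono[OF m_le[OF z], of "\<alpha> - 1"] alpha by linarith
  moreover have "1 / (\<alpha> - 1) < R" using R_ge alpha by (simp add: field_simps)
  moreover have "R \<le> Re z" by (rule Re_ge[OF z])
  ultimately show ?thesis using abs_Re_le_cmod[of "\<phi> z - z"] by simp
qed

lemma boettcher_real:
  assumes z: "z \<in> A" and real: "\<And>n. Im ((f ^^ n) z) = 0"
  shows "Im (\<phi> z) = 0"
proof -
  have "(\<lambda>n. Im (1 / of_real \<alpha> ^ n * (f ^^ n) z)) \<longlonglongrightarrow> Im (\<phi> z)"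
    by (intro tendsto_Im tendsto_boettcher z)
  moreover have "Im (1 / of_real \<alpha> ^ n * (f ^^ n) z) = 0" for n
  proof -
    have "1 / of_real \<alpha> ^ n * (f ^^ n) z = of_real (1 / \<alpha> ^ n) * (f ^^ n) z" by simp
    then show ?thesis using real[of n] by (simp only: Im_complex_of_real times_complex.sel)
  qed
  ultimately have "(\<lambda>n. 0) \<longlonglongrightarrow> Im (\<phi> z)" by (simp only:)
  then show ?thesis by (simp add: LIMSEQ_const_iff)
qed

text \<open>Once the orbit has passed \<open>N\<close>, \<psi> differs from the identity by at most
  1 along it. Dividing by \<open>\<alpha> ^ n\<close> shrinks this difference to 0, while
  \<open>\<psi> ((f ^^ n) z) / \<alpha> ^ n\<close> stays equal to \<open>\<psi> z\<close>.\<close>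

lemma boettcher_unique:
  assumes D: "B \<subseteq> A" "f ` B \<subseteq> B"
    and eq: "\<And>z. z \<in> B \<Longrightarrow> \<psi> (f z) = of_real \<alpha> * \<psi> z"
    and bound: "\<And>z. z \<in> B \<Longrightarrow> N \<le> Re z \<Longrightarrow> norm (\<psi> z - z) \<le> 1"
    and z: "z \<in> B"
  shows "\<psi> z = \<phi> z"
proof -
  have inB: "(f ^^ n) z \<in> B" for n using z D(2) by (induction n) auto
  have pow: "\<psi> ((f ^^ n) z) = of_real \<alpha> ^ n * \<psi> z" for n
    by (induction n) (auto simp: eq[OF inB])
  have "(\<lambda>n. 1 / of_real \<alpha> ^ n * (f ^^ n) z - \<psi> z) \<longlonglongrightarrow> 0"
  proof (rule Lim_null_comparison)
    show "(\<lambda>n. (1 / \<alpha>) ^ n) \<longlonglongrightarrow> 0" using alpha by (intro LIMSEQ_realpow_zero) auto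
    obtain n0 :: nat where n0: "N - Re z \<le> real n0" using real_arch_simple by blast
    show "\<forall>\<^sub>F n in sequentially. norm (1 / of_real \<alpha> ^ n * (f ^^ n) z - \<psi> z) \<le> (1 / \<alpha>) ^ n"
      unfolding eventually_sequentially
    proof (intro exI[of _ n0] allI impI)
      fix n assume n: "n0 \<le> n"
      have "N \<le> Re ((f ^^ n) z)" using Re_iterate[of z n] z D(1) n n0 by force
      then have b: "norm (\<psi> ((f ^^ n) z) - (f ^^ n) z) \<le> 1" using bound inB by blast
      have "1 / of_real \<alpha> ^ n * (f ^^ n) z - \<psi> z = - (\<psi> ((f ^^ n) z) - (f ^^ n) z) / of_real \<alpha> ^ n"
        using alpha by (simp add: pow field_simps)
      then have "norm (1 / of_real \<alpha> ^ n * (f ^^ n) z - \<psi> z) = norm (\<psi> ((f ^^ n) z) - (f ^^ n) z) / \<alpha> ^ n"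
        using alpha by (simp only: norm_divide norm_minus_cancel norm_power norm_of_real)
      also have "\<dots> \<le> 1 / \<alpha> ^ n" using b alpha by (intro divide_right_mono) auto
      finally show "norm (1 / of_real \<alpha> ^ n * (f ^^ n) z - \<psi> z) \<le> (1 / \<alpha>) ^ n"
        by (simp add: power_divide)
    qed
  qed
  then have "(\<lambda>n. 1 / of_real \<alpha> ^ n * (f ^^ n) z) \<longlonglongrightarrow> \<psi> z" by (simp add: LIM_zero_iff)
  then show ?thesis using tendsto_boettcher[of z] z D(1) LIMSEQ_unique by blast
qed

section \<open>Continuity and holomorphy of the limit\<close>

lemma continuous_on_iterate:
  assumes "continuous_on A f"
  shows "continuous_on A (f ^^ n)"
proof (induction n)
  case (Suc n)
  then have "continuous_on A (\<lambda>z. f ((f ^^ n) z))"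
    by (intro continuous_on_compose2[OF assms]) (auto intro: iterate_in)
  then show ?case by (simp add: o_def)
qed (simp add: id_def)

text \<open>A point of the interior may be mapped to the boundary only if \<open>f\<close> is constant near it, by the
  open mapping theorem; in both cases the iterates stay holomorphic.\<close>

lemma holomorphic_iterate:
  assumes hol: "f holomorphic_on interior A"
  shows "(f ^^ n) holomorphic_on interior A"
proof (induction n)
  case (Suc n)
  have "(f ^^ Suc n) field_differentiable at z" if z: "z \<in> interior A" for z
  proof -
    obtain e where e: "e > 0" "ball z e \<subseteq> interior A"
      using z open_interior open_contains_ball by blast
    have hb: "f holomorphic_on ball z e" using hol e(2) holomorphic_on_subset by blast
    have "(f ^^ Suc n) holomorphic_on ball z e"
    proof (cases "f constant_on ball z e")
      case True
      then obtain c where "\<And>w. w \<in> ball z e \<Longrightarrow> f w = c" unfolding constant_on_def by blast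
      then have "\<And>w. w \<in> ball z e \<Longrightarrow> (f ^^ Suc n) w = (f ^^ n) c" by (simp add: funpow_swap1)
      then show ?thesis using holomorphic_transform[OF holomorphic_on_const] by metis
    next
      case False
      then have "open (f ` ball z e)" using open_mapping_thm[OF hb] by auto
      moreover have "f ` ball z e \<subseteq> A" using e(2) interior_subset inv by blast
      ultimately have "f ` ball z e \<subseteq> interior A" by (rule interior_maximal[rotated])
      then have "((f ^^ n) \<circ> f) holomorphic_on ball z e"
        using holomorphic_on_compose_gen[OF hb Suc.IH] by blast
      then show ?thesis by (simp add: funpow_Suc_right del: funpow.simps)
    qed
    then show ?thesis using e(1) holomorphic_on_imp_differentiable_at by (metis centre_in_ball open_ball)
  qed
  then show ?case
    unfolding holomorphic_on_def using field_differentiable_at_within by blast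
qed (simp add: id_def)

lemma analytic_map_boettcher:
  assumes "analytic_map f A"
  shows "analytic_map \<phi> A"
  unfolding analytic_map_def
proof
  have cont: "continuous_on A f" and hol: "f holomorphic_on interior A"
    using assms by (auto simp: analytic_map_def)
  show "continuous_on A \<phi>"
    by (rule uniform_limit_theorem[OF _ uniform_limit_boettcher],
        intro always_eventually allI continuous_on_mult continuous_on_const continuous_on_iterate[OF cont])
      simp
  show "\<phi> holomorphic_on interior A"
  proof (rule holomorphic_uniform_sequence[OF open_interior])
    show "(\<lambda>z. 1 / of_real \<alpha> ^ n * (f ^^ n) z) holomorphic_on interior A" for n
      by (intro holomorphic_intros holomorphic_iterate[OF hol]) (use alpha in auto)
    fix z assume "z \<in> interior A"
    then obtain d where d: "d > 0" "cball z d \<subseteq> interior A"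
      using open_interior open_contains_cball by blast
    then have "cball z d \<subseteq> A" using interior_subset by blast
    then have "uniform_limit (cball z d) (\<lambda>n z. 1 / of_real \<alpha> ^ n * (f ^^ n) z) \<phi> sequentially"
      using uniform_limit_on_subset[OF uniform_limit_boettcher] by blast
    then show "\<exists>d>0. cball z d \<subseteq> interior A \<and>
        uniform_limit (cball z d) (\<lambda>n z. 1 / of_real \<alpha> ^ n * (f ^^ n) z) \<phi> sequentially"
      using d by blast
  qed
qed

text \<open>Near a point of \<open>B\<close> the map \<open>f\<close> takes values in the interior
  of \<open>A\<close>, where \<phi> is holomorphic, so
  \<open>\<phi> = (\<phi> \<circ> f) / \<alpha>\<close> is holomorphic on a full neighbourhood, even
  one that leaves \<open>A\<close>.\<close>

lemma boettcher_analytic_on: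
  assumes f: "f analytic_on B" and phi: "\<phi> holomorphic_on interior A" and sub: "f ` B \<subseteq> interior A"
  shows "\<phi> analytic_on B"
  unfolding analytic_on_def
proof
  fix z assume z: "z \<in> B"
  obtain d where d: "d > 0" "f holomorphic_on ball z d"
    using f z unfolding analytic_on_def by blast
  have "open (ball z d \<inter> f -` interior A)"
    using holomorphic_on_imp_continuous_on[OF d(2)] by (intro continuous_open_preimage) auto
  moreover have "z \<in> ball z d \<inter> f -` interior A" using d sub z by auto
  ultimately obtain e where e: "e > 0" "ball z e \<subseteq> ball z d \<inter> f -` interior A"
    using open_contains_ball by blast
  have "(\<phi> \<circ> f) holomorphic_on ball z e"
  proof (rule holomorphic_on_compose_gen[OF _ phi])
    show "f holomorphic_on ball z e" using d(2) e(2) holomorphic_on_subset by blast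
  qed (use e(2) in auto)
  then have "(\<lambda>w. \<phi> (f w) / of_real \<alpha>) holomorphic_on ball z e"
    unfolding o_def by (intro holomorphic_on_divide holomorphic_on_const) (use alpha in auto)
  then have "\<phi> holomorphic_on ball z e"
    by (rule holomorphic_transform) (use e(2) interior_subset boettcher_eq_shift in fastforce)
  then show "\<exists>e>0. \<phi> holomorphic_on ball z e" using e(1) by blast
qed

end

section \<open>The normalization theorem\<close>

text \<open>Collects what it means for \<open>R\<close> to be sufficiently large. The bound
  \<open>half_close\<close> is stated for all points of the domain beyond \<open>R\<close>, not just
  for \<open>A\<close>, because truncated regions must be shown invariant before they are known to
  lie in \<open>A\<close>.\<close>

locale admissible_perturbation =
  fixes \<alpha> \<epsilon> C R :: real and k :: nat and D :: "complex set" and f :: "complex \<Rightarrow> complex"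
  assumes alpha_gt_1: "\<alpha> > 1" and epsilon_pos: "\<epsilon> > 0"
    and C_gt: "C > (exp ^^ k) 0" and C_le_R: "C \<le> R" and two_le: "2 \<le> (\<alpha> - 1) * R"
    and M_R_le_1: "M_fun \<epsilon> k R \<le> 1"
    and half_close: "z \<in> right_part D C \<Longrightarrow> R \<le> Re z \<Longrightarrow>
      norm (f z - of_real \<alpha> * z) \<le> M_fun \<epsilon> k (Re z) / 2"
begin

abbreviation A where "A \<equiv> inv_right_part f D C R"

lemma R_gt: "(exp ^^ k) 0 < R"
  using C_gt C_le_R by linarith

lemma inv_right_part_eq: "A = right_part (max_invariant f (right_part D C)) R"
  by (simp add: inv_right_part_def)

lemma A_subset: "A \<subseteq> right_part D C"
  using max_invariant_subset by (auto simp: inv_right_part_eq right_part_def)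

lemma A_Re: "z \<in> A \<Longrightarrow> R \<le> Re z"
  by (simp add: inv_right_part_eq right_part_def)

text \<open>The estimate of \<open>Re_step\<close>, for points not yet known to lie in
  \<open>A\<close>. It ensures that truncating an invariant set at \<open>R\<close> keeps it
  invariant, which must be known before \<open>perturbed_scaling\<close> applies to
  \<open>A\<close>.\<close>

lemma Re_stays_right:
  assumes z: "z \<in> right_part D C" "R \<le> Re z"
  shows "R \<le> Re (f z)"
proof -
  have "M_fun \<epsilon> k (Re z) \<le> 1"
    using M_fun_antimono[OF epsilon_pos R_gt z(2)] M_R_le_1 by linarith
  then have "norm (f z - of_real \<alpha> * z) \<le> 1" using half_close[OF z] by linarith
  then have "\<alpha> * Re z - 1 \<le> Re (f z)"
    using abs_Re_le_cmod[of "f z - of_real \<alpha> * z"] by simp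
  moreover have "(\<alpha> - 1) * R \<le> (\<alpha> - 1) * Re z" using alpha_gt_1 z by (intro mult_left_mono) auto
  ultimately show ?thesis using two_le z by (simp add: algebra_simps)
qed

lemma right_part_invariant:
  assumes "B \<subseteq> right_part D C" "invariant_under f B"
  shows "f ` right_part B R \<subseteq> right_part B R"
proof clarify
  fix z assume "z \<in> right_part B R"
  then have z: "z \<in> B" "R \<le> Re z" by (simp_all add: right_part_def)
  then have "f z \<in> B" using assms(2) by (auto simp: invariant_under_def)
  then show "f z \<in> right_part B R"
    using Re_stays_right z assms(1) by (auto simp: right_part_def)
qed

lemma A_invariant: "f ` A \<subseteq> A"
  unfolding inv_right_part_eq by (rule right_part_invariant[OF max_invariant_subset invariant_max_invariant])

sublocale perturbed_scaling f \<alpha> R A "M_fun \<epsilon> k"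
proof
  show "norm (f z - of_real \<alpha> * z) \<le> M_fun \<epsilon> k (Re z)" if z: "z \<in> A" for z
  proof -
    have "0 < M_fun \<epsilon> k (Re z)" using A_Re[OF z] R_gt by (intro M_fun_pos) auto
    then show ?thesis using half_close[OF subsetD[OF A_subset z] A_Re[OF z]] by linarith
  qed
  show "M_fun \<epsilon> k y \<le> M_fun \<epsilon> k x" if "R \<le> x" "x \<le> y" for x y
    using that R_gt by (intro M_fun_antimono epsilon_pos) auto
qed (use alpha_gt_1 two_le M_R_le_1 A_invariant A_Re in auto)

lemma right_part_subset: "E \<subseteq> D \<Longrightarrow> right_part E R \<subseteq> right_part D C"
  using C_le_R by (auto simp: right_part_def)

text \<open>The image is interior because half of the positive \<open>M_fun\<close> is strictly
  below the error allowed in \<open>type_domain_step\<close>.\<close>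

lemma type_domain_image_interior:
  assumes E: "type_domain \<alpha> \<epsilon> k E" "E \<subseteq> D"
  shows "f ` right_part E R \<subseteq> interior (right_part E R)"
proof clarify
  fix z assume z: "z \<in> right_part E R"
  then have zR: "R \<le> Re z" by (simp add: right_part_def)
  have "0 < M_fun \<epsilon> k (Re z)" using zR R_gt by (intro M_fun_pos) auto
  then have "norm (f z - of_real \<alpha> * z) < M_fun \<epsilon> k (Re z)"
    using half_close[OF subsetD[OF right_part_subset[OF E(2)] z] zR] by linarith
  then show "f z \<in> interior (right_part E R)"
    by (rule type_domain_step[OF type_domain_right_part[OF E(1)] alpha_gt_1 z])
qed

lemma right_part_subset_A:
  assumes "B \<subseteq> right_part D C" and "f ` B \<subseteq> B"
  shows "right_part B R \<subseteq> A"
  using max_invariant_maximal[of B "right_part D C" f] assms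
  by (auto simp: inv_right_part_eq right_part_def invariant_under_def)

lemma type_domain_subset_A:
  assumes E: "type_domain \<alpha> \<epsilon> k E" "E \<subseteq> D"
  shows "right_part E R \<subseteq> A"
proof -
  have "f ` right_part E R \<subseteq> right_part E R"
    using type_domain_image_interior[OF E] interior_subset by (rule order_trans)
  \<comment> \<open>This truncates \<open>right_part E R\<close> at \<open>R\<close> a second time,
    which has no effect.\<close>
  from right_part_subset_A[OF right_part_subset[OF E(2)] this]
  show ?thesis by (simp add: right_part_def)
qed

lemma admissible_A:
  assumes "admissible_domain \<alpha> \<epsilon> k D"
  shows "admissible_domain \<alpha> \<epsilon> k A"
proof -
  obtain E where E: "type_domain \<alpha> \<epsilon> k E" "E \<subseteq> D"
    using assms unfolding admissible_domain_def by blast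
  show ?thesis
    unfolding admissible_domain_def
    using type_domain_right_part[OF E(1)] type_domain_subset_A[OF E] by blast
qed

lemma analytic_map_boettcher_A:
  assumes "analytic_map f (right_part D C)"
  shows "analytic_map \<phi> A"
proof (rule analytic_map_boettcher)
  show "analytic_map f A"
    using assms A_subset interior_mono[OF A_subset] continuous_on_subset holomorphic_on_subset
    unfolding analytic_map_def by blast
qed

text \<open>Points of a truncated region need not be interior to \<open>A\<close>, but one
  application of \<open>f\<close> moves them into the interior, from where \<phi> is pulled
  back.\<close>

lemma boettcher_analytic_on_type_domain:
  assumes map: "analytic_map f (right_part D C)" and f: "f analytic_on right_part D C"
    and E: "type_domain \<alpha> \<epsilon> k E" "E \<subseteq> D"
  shows "\<phi> analytic_on right_part E R"
proof (rule boettcher_analytic_on)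
  show "f analytic_on right_part E R" by (rule analytic_on_subset[OF f right_part_subset[OF E(2)]])
  show "\<phi> holomorphic_on interior A"
    using analytic_map_boettcher_A[OF map] by (simp add: analytic_map_def)
  show "f ` right_part E R \<subseteq> interior A"
    using type_domain_image_interior[OF E] interior_mono[OF type_domain_subset_A[OF E]] by (rule order_trans)
qed

text \<open>Invariance keeps the whole orbit real, so its rescaled limit is real; positivity comes
  from \<open>Re_boettcher_pos\<close>. The images are located on the positive real axis.\<close>

lemma boettcher_real_axis:
  assumes "invariant_under f (A \<inter> {\<zeta>. Re \<zeta> > 0 \<and> Im \<zeta> = 0})"
  shows "\<phi> ` (A \<inter> {\<zeta>. Re \<zeta> > 0 \<and> Im \<zeta> = 0}) \<subseteq> {\<zeta>. Re \<zeta> > 0 \<and> Im \<zeta> = 0}"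
proof clarify
  fix z assume z: "z \<in> A" "0 < Re z" "Im z = 0"
  have "(f ^^ n) z \<in> A \<inter> {\<zeta>. Re \<zeta> > 0 \<and> Im \<zeta> = 0}" for n
    using z assms by (induction n) (auto simp: invariant_under_def)
  then have "Im ((f ^^ n) z) = 0" for n by blast
  then show "0 < Re (\<phi> z) \<and> Im (\<phi> z) = 0"
    using Re_boettcher_pos[OF z(1)] boettcher_real[OF z(1)] by blast
qed

text \<open>Common source of both asymptotic statements, which differ only in what
  \<open>M_fun\<close> is compared with.\<close>

lemma boettcher_bigo:
  assumes "B \<subseteq> A"
  shows "(\<lambda>z. \<phi> z - z) \<in> O[re_at_top B](\<lambda>z. of_real (M_fun \<epsilon> k (Re z)))"
proof (rule bigoI)
  have "norm (\<phi> z - z) \<le> 1 / (\<alpha> - 1) * norm (complex_of_real (M_fun \<epsilon> k (Re z)))" if "z \<in> B" for z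
    using boettcher_norm_diff[of z] m_nonneg[of z] that assms by auto
  then show "\<forall>\<^sub>F z in re_at_top B.
      norm (\<phi> z - z) \<le> 1 / (\<alpha> - 1) * norm (complex_of_real (M_fun \<epsilon> k (Re z)))"
    unfolding eventually_re_at_top by blast
qed

lemma boettcher_smallo_1: "(\<lambda>z. \<phi> z - z) \<in> o[re_at_top A](\<lambda>_. 1)"
proof -
  have "filterlim Re at_top (re_at_top A)"
    by (auto simp: filterlim_at_top eventually_re_at_top)
  then have "((\<lambda>z. M_fun \<epsilon> k (Re z)) \<longlongrightarrow> 0) (re_at_top A)"
    by (rule filterlim_compose[OF M_fun_tendsto_0[OF epsilon_pos]])
  then have "((\<lambda>z. complex_of_real (M_fun \<epsilon> k (Re z))) \<longlongrightarrow> of_real 0) (re_at_top A)"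
    by (rule tendsto_of_real)
  then have "(\<lambda>z. of_real (M_fun \<epsilon> k (Re z))) \<in> o[re_at_top A](\<lambda>_. 1 :: complex)"
    by (intro smalloI_tendsto) auto
  with boettcher_bigo[OF order_refl] show ?thesis by (rule landau_o.big_small_trans)
qed

lemma boettcher_smallo_L_fun:
  assumes \<nu>: "0 < \<nu>" "\<nu> < \<epsilon>" and sub: "region t hl hu \<subseteq> A"
    and O: "hl \<in> O[at_top](\<lambda>x. x)" "hu \<in> O[at_top](\<lambda>x. x)"
  shows "(\<lambda>z. \<phi> z - z) \<in> o[re_at_top (region t hl hu)](\<lambda>z. L_fun k z powr of_real (- \<nu>))"
proof -
  obtain K X where "\<And>z. z \<in> region t hl hu \<Longrightarrow> X \<le> Re z \<Longrightarrow> norm z \<le> K * Re z"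
    using region_sector[OF O] by blast
  from boettcher_bigo[OF sub] M_fun_smallo_on_sector[OF \<nu> this]
  show ?thesis by (rule landau_o.big_small_trans)
qed

text \<open>\<open>B\<close> lies in the maximal invariant set, so its truncation at
  \<open>R\<close> lies in \<open>A\<close>. The o(1) hypothesis supplies a line beyond which \<psi>
  is within 1 of the identity.\<close>

lemma normalization_unique:
  assumes B: "B \<subseteq> right_part D C" "invariant_under f B"
    and eq: "\<forall>\<zeta> \<in> B. \<psi> (f \<zeta>) = of_real \<alpha> * \<psi> \<zeta>"
    and o: "(\<lambda>\<zeta>. \<psi> \<zeta> - \<zeta>) \<in> o[re_at_top B](\<lambda>_. 1)"
    and z: "z \<in> right_part B R"
  shows "\<psi> z = \<phi> z"
proof -
  obtain N where N: "\<And>z. z \<in> B \<Longrightarrow> N \<le> Re z \<Longrightarrow> norm (\<psi> z - z) \<le> 1"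
    using landau_o.smallD[OF o, of 1] unfolding eventually_re_at_top by auto
  show ?thesis
  proof (rule boettcher_unique[OF _ _ _ _ z])
    show "right_part B R \<subseteq> A"
      using B by (intro right_part_subset_A) (auto simp: invariant_under_def)
    show "f ` right_part B R \<subseteq> right_part B R" by (rule right_part_invariant[OF B])
    show "\<psi> (f z) = of_real \<alpha> * \<psi> z" if "z \<in> right_part B R" for z
      using eq that by (simp add: right_part_def)
    show "norm (\<psi> z - z) \<le> 1" if "z \<in> right_part B R" "N \<le> Re z" for z
      using N that by (simp add: right_part_def)
  qed
qed

end

lemma ex_admissible_perturbation:
  assumes "\<alpha> > 1" and "\<epsilon> > 0" and "C > (exp ^^ k) 0"
    and o: "(\<lambda>\<zeta>. f \<zeta> - of_real \<alpha> * \<zeta>)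
           \<in> o[re_at_top (right_part D C)](\<lambda>\<zeta>. L_fun k \<zeta> powr of_real (- \<epsilon>))"
  shows "\<exists>R\<^sub>0 > (exp ^^ k) 0. \<forall>R \<ge> R\<^sub>0. admissible_perturbation \<alpha> \<epsilon> C R k D f"
proof -
  obtain N where N: "\<And>z. z \<in> right_part D C \<Longrightarrow> N \<le> Re z \<Longrightarrow>
      norm (f z - of_real \<alpha> * z) \<le> 1/2 * norm (L_fun k z powr of_real (- \<epsilon>))"
    using landau_o.smallD[OF o, of "1/2"] unfolding eventually_re_at_top by auto
  have "\<forall>\<^sub>F x in at_top. M_fun \<epsilon> k x < 1"
    using M_fun_tendsto_0[OF assms(2)] by (rule order_tendstoD) simp
  then obtain N1 where N1: "\<And>x. N1 \<le> x \<Longrightarrow> M_fun \<epsilon> k x < 1"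
    unfolding eventually_at_top_linorder by blast
  \<comment> \<open>One entry per requirement: \<open>N\<close> for the half bound,
    \<open>N1\<close> for \<open>M_fun \<epsilon> k R \<le> 1\<close>, \<open>C\<close> for the
    domain of \<open>f\<close>, and the last for the gain of 2 in the real part.\<close>
  define R\<^sub>0 where "R\<^sub>0 = Max {N, N1, C, 2 / (\<alpha> - 1)}"
  have R0: "N \<le> R\<^sub>0" "N1 \<le> R\<^sub>0" "C \<le> R\<^sub>0" "2 / (\<alpha> - 1) \<le> R\<^sub>0"
    unfolding R\<^sub>0_def by auto
  have "admissible_perturbation \<alpha> \<epsilon> C R k D f" if R: "R\<^sub>0 \<le> R" for R
  proof
    have "2 / (\<alpha> - 1) \<le> R" using R R0 by linarith
    then show "2 \<le> (\<alpha> - 1) * R" using assms(1) by (simp add: field_simps)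
    show "M_fun \<epsilon> k R \<le> 1" using N1[of R] R R0 by linarith
    show "norm (f z - of_real \<alpha> * z) \<le> M_fun \<epsilon> k (Re z) / 2"
      if z: "z \<in> right_part D C" "R \<le> Re z" for z
      using N[of z] norm_L_fun_powr_le_M_fun[OF assms(2), of k z] z R R0 assms(3) by simp
  qed (use assms R R0 in auto)
  moreover have "(exp ^^ k) 0 < R\<^sub>0" using R0 assms(3) by linarith
  ultimately show ?thesis by blast
qed

theorem theoremB:
  fixes \<alpha> \<epsilon> C :: real and k :: nat and D :: "complex set" and f :: "complex \<Rightarrow> complex"
  assumes "\<alpha> > 1" and "\<epsilon> > 0"
    and "D \<subseteq> {\<zeta>. Re \<zeta> > 0}"
    and "admissible_domain \<alpha> \<epsilon> k D"
    and "C > (exp ^^ k) 0"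
    and "analytic_map f (right_part D C)"
    and "(\<lambda>\<zeta>. f \<zeta> - of_real \<alpha> * \<zeta>)
           \<in> o[re_at_top (right_part D C)](\<lambda>\<zeta>. L_fun k \<zeta> powr of_real (- \<epsilon>))"
  shows "\<exists>R\<^sub>0 > (exp ^^ k) 0. \<forall>R \<ge> R\<^sub>0.
    inv_right_part f D C R \<subseteq> D \<and>
    admissible_domain \<alpha> \<epsilon> k (inv_right_part f D C R) \<and>
    invariant_under f (inv_right_part f D C R) \<and>
    (\<exists>\<phi>.
      analytic_map \<phi> (inv_right_part f D C R) \<and>
      (f analytic_on right_part D C \<longrightarrow>
        (\<forall>E. type_domain \<alpha> \<epsilon> k E \<and> E \<subseteq> D \<longrightarrow>
           right_part E R \<subseteq> inv_right_part f D C R \<and> \<phi> analytic_on right_part E R)) \<and>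
      (\<forall>\<zeta> \<in> inv_right_part f D C R. \<phi> (f \<zeta>) = of_real \<alpha> * \<phi> \<zeta>) \<and>
      uniform_limit (inv_right_part f D C R)
        (\<lambda>n \<zeta>. 1 / of_real \<alpha> ^ n * (f ^^ n) \<zeta>) \<phi> sequentially \<and>

      (invariant_under f (inv_right_part f D C R \<inter> {\<zeta>. Re \<zeta> > 0 \<and> Im \<zeta> = 0}) \<longrightarrow>
        \<phi> ` (inv_right_part f D C R \<inter> {\<zeta>. Re \<zeta> > 0 \<and> Im \<zeta> = 0})
          \<subseteq> {\<zeta>. Re \<zeta> > 0 \<and> Im \<zeta> = 0}) \<and>

      (\<lambda>\<zeta>. \<phi> \<zeta> - \<zeta>) \<in> o[re_at_top (inv_right_part f D C R)](\<lambda>_. 1) \<and>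
      (\<forall>\<nu> t hl hu. 0 < \<nu> \<and> \<nu> < \<epsilon> \<and> lower_upper_pair \<alpha> \<epsilon> k t hl hu \<and>
          region t hl hu \<subseteq> inv_right_part f D C R \<and>
          hl \<in> O[at_top](\<lambda>x. x) \<and> hu \<in> O[at_top](\<lambda>x. x) \<longrightarrow>
        (\<lambda>\<zeta>. \<phi> \<zeta> - \<zeta>) \<in> o[re_at_top (region t hl hu)](\<lambda>\<zeta>. L_fun k \<zeta> powr of_real (- \<nu>))) \<and>

      (\<forall>D\<^sub>1 \<psi>. D\<^sub>1 \<subseteq> right_part D C \<and> invariant_under f D\<^sub>1 \<and> analytic_map \<psi> D\<^sub>1 \<and>
          (\<forall>\<zeta> \<in> D\<^sub>1. \<psi> (f \<zeta>) = of_real \<alpha> * \<psi> \<zeta>) \<and>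
          (\<lambda>\<zeta>. \<psi> \<zeta> - \<zeta>) \<in> o[re_at_top D\<^sub>1](\<lambda>_. 1) \<longrightarrow>
        (\<forall>\<zeta> \<in> right_part D\<^sub>1 R. \<psi> \<zeta> = \<phi> \<zeta>)))"
proof -
  obtain R\<^sub>0 where R0: "R\<^sub>0 > (exp ^^ k) 0" "\<forall>R \<ge> R\<^sub>0. admissible_perturbation \<alpha> \<epsilon> C R k D f"
    using ex_admissible_perturbation[OF assms(1,2,5,7)] by blast
  show ?thesis
  proof (intro exI[of _ R\<^sub>0] conjI R0(1) allI impI)
    fix R assume "R\<^sub>0 \<le> R"
    then interpret admissible_perturbation \<alpha> \<epsilon> C R k D f using R0(2) by blast
    show "inv_right_part f D C R \<subseteq> D"
      using A_subset by (auto simp: right_part_def)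
    show "admissible_domain \<alpha> \<epsilon> k (inv_right_part f D C R)"
      by (rule admissible_A[OF assms(4)])
    show "invariant_under f (inv_right_part f D C R)"
      unfolding invariant_under_def by (rule A_invariant)
    show "\<exists>\<phi>.
      analytic_map \<phi> (inv_right_part f D C R) \<and>
      (f analytic_on right_part D C \<longrightarrow>
        (\<forall>E. type_domain \<alpha> \<epsilon> k E \<and> E \<subseteq> D \<longrightarrow>
           right_part E R \<subseteq> inv_right_part f D C R \<and> \<phi> analytic_on right_part E R)) \<and>
      (\<forall>\<zeta> \<in> inv_right_part f D C R. \<phi> (f \<zeta>) = of_real \<alpha> * \<phi> \<zeta>) \<and>
      uniform_limit (inv_right_part f D C R)
        (\<lambda>n \<zeta>. 1 / of_real \<alpha> ^ n * (f ^^ n) \<zeta>) \<phi> sequentially \<and>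
      (invariant_under f (inv_right_part f D C R \<inter> {\<zeta>. Re \<zeta> > 0 \<and> Im \<zeta> = 0}) \<longrightarrow>
        \<phi> ` (inv_right_part f D C R \<inter> {\<zeta>. Re \<zeta> > 0 \<and> Im \<zeta> = 0})
          \<subseteq> {\<zeta>. Re \<zeta> > 0 \<and> Im \<zeta> = 0}) \<and>
      (\<lambda>\<zeta>. \<phi> \<zeta> - \<zeta>) \<in> o[re_at_top (inv_right_part f D C R)](\<lambda>_. 1) \<and>
      (\<forall>\<nu> t hl hu. 0 < \<nu> \<and> \<nu> < \<epsilon> \<and> lower_upper_pair \<alpha> \<epsilon> k t hl hu \<and>
          region t hl hu \<subseteq> inv_right_part f D C R \<and>
          hl \<in> O[at_top](\<lambda>x. x) \<and> hu \<in> O[at_top](\<lambda>x. x) \<longrightarrow>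
        (\<lambda>\<zeta>. \<phi> \<zeta> - \<zeta>) \<in> o[re_at_top (region t hl hu)](\<lambda>\<zeta>. L_fun k \<zeta> powr of_real (- \<nu>))) \<and>
      (\<forall>D\<^sub>1 \<psi>. D\<^sub>1 \<subseteq> right_part D C \<and> invariant_under f D\<^sub>1 \<and> analytic_map \<psi> D\<^sub>1 \<and>
          (\<forall>\<zeta> \<in> D\<^sub>1. \<psi> (f \<zeta>) = of_real \<alpha> * \<psi> \<zeta>) \<and>
          (\<lambda>\<zeta>. \<psi> \<zeta> - \<zeta>) \<in> o[re_at_top D\<^sub>1](\<lambda>_. 1) \<longrightarrow>
        (\<forall>\<zeta> \<in> right_part D\<^sub>1 R. \<psi> \<zeta> = \<phi> \<zeta>))"
      \<comment> \<open>The witness \<open>boettcher_limit \<alpha> f\<close> is the same for every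
        \<open>R\<close>; only the set on which it is considered changes.\<close>
      by (intro exI[of _ \<phi>] conjI allI impI ballI analytic_map_boettcher_A[OF assms(6)]
          uniform_limit_boettcher boettcher_smallo_1;
        (elim conjE)?,
        (rule type_domain_subset_A boettcher_analytic_on_type_domain[OF assms(6)] boettcher_functional
          boettcher_real_axis boettcher_smallo_L_fun normalization_unique; assumption))
  qed
qed

end
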